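(* Let $k$, $n$ and $s$ be positive integers and let $x_1,\ldots,x_n$ be independent variables. Then $$H_k^{(s-1)}(x_1,\ldots,x_n)=\sum_{j=0}^{\lfloor k/s\rfloor}(-1)^{sj}h_j(x_1^s,\ldots,x_n^s)\,e_{k-sj}(x_1,\ldots,x_n)$$ and $$E_k^{(s-1)}(x_1,\ldots,x_n)=\sum_{j=0}^{\lfloor k/s\rfloor}(-1)^{j}e_j(x_1^s,\ldots,x_n^s)\,h_{k-sj}(x_1,\ldots,x_n).$$
   Context: For a nonnegative integer $r$, $H_k^{(r)}$ and $E_k^{(r)}$ ($k\ge0$) are defined by the formal power series identities $$\sum_{k\ge0}H_k^{(r)}(x_1,\ldots,x_n)t^k=\prod_{i=1}^n\big(1-x_it+\cdots+(-x_it)^r\big)^{-1},\qquad \sum_{k\ge0}E_k^{(r)}(x_1,\ldots,x_n)t^k=\prod_{i=1}^n\big(1+x_it+\cdots+(x_it)^r\big)$$ (for $r=0$ each factor equals $1$). $h_j$ and $e_j$ denote the complete homogeneous and elementary symmetric functions. *)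

theory Defs
  imports
    "HOL-Library.Multiset"
    "HOL-Library.Poly_Mapping"
    "HOL-Computational_Algebra.Formal_Power_Series"
begin

text \<open>
  Polynomials over \<open>'a\<close> in countably many independent variables: finitely supported maps
  from monomials (exponent vectors) to coefficients, with convolution as multiplication.
\<close>

type_synonym 'a mpoly = "(nat \<Rightarrow>\<^sub>0 nat) \<Rightarrow>\<^sub>0 'a"

definition indet :: "nat \<Rightarrow> 'a::comm_ring_1 mpoly" where
  "indet i = Poly_Mapping.single (Poly_Mapping.single i 1) 1"

text \<open>
  The symmetric functions below are evaluated at a family \<open>x\<close> of elements of a commutative
  ring, of which only \<open>x 1, \<dots>, x n\<close> are used; so \<open>h\<^sub>j(x\<^sub>1\<^sup>s, \<dots>, x\<^sub>n\<^sup>s)\<close> is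
  \<open>complete_sym j n (\<lambda>i. x i ^ s)\<close>.
\<close>

definition elem_sym :: "nat \<Rightarrow> nat \<Rightarrow> (nat \<Rightarrow> 'b) \<Rightarrow> 'b::comm_ring_1" where
  "elem_sym j n x = (\<Sum>S | S \<subseteq> {1..n} \<and> card S = j. \<Prod>i\<in>S. x i)"

definition complete_sym :: "nat \<Rightarrow> nat \<Rightarrow> (nat \<Rightarrow> 'b) \<Rightarrow> 'b::comm_ring_1" where
  "complete_sym j n x = (\<Sum>M\<in>multisets_of_size {1..n} j. \<Prod>i\<in>#M. x i)"

definition trunc_geom :: "nat \<Rightarrow> 'b \<Rightarrow> 'b::comm_ring_1 fps" where
  "trunc_geom r a = (\<Sum>m=0..r. (fps_const a * fps_X) ^ m)"

lemma trunc_geom_nth_0: "fps_nth (trunc_geom r a) 0 = 1"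
proof -
  have "fps_nth ((fps_const a * fps_X) ^ m) 0 = (if m = 0 then 1 else 0)" for m
    by (simp add: fps_power_zeroth power_0_left)
  then show ?thesis
    by (simp add: trunc_geom_def fps_sum_nth)
qed

text \<open>
  The coefficient ring need not be a field, so the class operation \<open>inverse\<close> on power series
  is not available; \<open>fps_right_inverse f 1\<close> is the multiplicative inverse of a series \<open>f\<close> with
  constant coefficient 1.
\<close>

lemma trunc_geom_inverse: "trunc_geom r a * fps_right_inverse (trunc_geom r a) 1 = 1"
  by (rule fps_right_inverse) (simp add: trunc_geom_nth_0)

definition H_trunc :: "nat \<Rightarrow> nat \<Rightarrow> nat \<Rightarrow> (nat \<Rightarrow> 'b) \<Rightarrow> 'b::comm_ring_1" where
  "H_trunc r k n x = fps_nth (\<Prod>i=1..n. fps_right_inverse (trunc_geom r (- x i)) 1) k"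

definition E_trunc :: "nat \<Rightarrow> nat \<Rightarrow> nat \<Rightarrow> (nat \<Rightarrow> 'b) \<Rightarrow> 'b::comm_ring_1" where
  "E_trunc r k n x = fps_nth (\<Prod>i=1..n. trunc_geom r (x i)) k"

end

theory Submission
  imports Defs
begin

text \<open>
  The generating series of the \<open>e\<^sub>j\<close> is \<open>\<Prod>(1 + x\<^sub>i t)\<close>, that of the \<open>h\<^sub>j\<close> is
  \<open>\<Prod>(1 - x\<^sub>i t)\<^sup>-\<^sup>1\<close>, and the truncated geometric series satisfies
  \<open>(1 - a t)(1 + a t + \<dots> + (a t)\<^bsup>s-1\<^esup>) = 1 - a\<^sup>s t\<^sup>s\<close>. Taking products over the variables,
  \<open>\<Prod>(1 - x\<^sub>i\<^sup>s t\<^sup>s)\<close> and its inverse turn into series in \<open>t\<^sup>s\<close> with coefficients \<open>\<plusminus>e\<^sub>j\<close>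
  and \<open>h\<^sub>j\<close> of the \<open>x\<^sub>i\<^sup>s\<close>; comparing coefficients gives both identities, over any commutative ring.
\<close>

text \<open>
  The series \<open>\<Sum>\<^sub>j f j t\<^bsup>sj\<^esup>\<close>. Composition with \<open>fps_X ^ s\<close> is not used because the
  library shows its multiplicativity only over integral domains.
\<close>

definition fps_spread :: "nat \<Rightarrow> (nat \<Rightarrow> 'b) \<Rightarrow> 'b::comm_ring_1 fps" where
  "fps_spread s f = Abs_fps (\<lambda>m. if s dvd m then f (m div s) else 0)"

lemma fps_spread_nth: "fps_nth (fps_spread s f) m = (if s dvd m then f (m div s) else 0)"
  by (simp add: fps_spread_def)

lemma fps_spread_1_nth [simp]: "fps_nth (fps_spread (Suc 0) f) m = f m"
  by (simp add: fps_spread_nth)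

text \<open>Only multiples \<open>m = s * j\<close> of \<open>s\<close> survive in the Cauchy
  product, and \<open>s * j \<le> k\<close> amounts to \<open>j \<le> k div s\<close>; this yields
  the summation range of both identities.\<close>

lemma fps_spread_mult_nth:
  assumes "s \<ge> 1"
  shows "fps_nth (fps_spread s f * g) k = (\<Sum>j=0..k div s. f j * fps_nth g (k - s * j))"
proof -
  have "fps_nth (fps_spread s f * g) k =
          (\<Sum>m\<in>{m \<in> {0..k}. s dvd m}. f (m div s) * fps_nth g (k - m))"
    unfolding fps_mult_nth
    by (intro sum.mono_neutral_cong_right) (auto simp: fps_spread_nth)
  also have "\<dots> = (\<Sum>j=0..k div s. f j * fps_nth g (k - s * j))"
    using assms
    by (intro sum.reindex_bij_witness[of _ "\<lambda>j. s * j" "\<lambda>m. m div s"])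
       (auto simp: div_le_mono less_eq_div_iff_mult_less_eq mult.commute)
  finally show ?thesis .
qed

text \<open>Homogeneity of degree \<open>j\<close>. This and its analogue for
  \<open>complete_sym\<close> pull the signs out of the coefficients.\<close>

lemma elem_sym_scale: "elem_sym j n (\<lambda>i. c * x i) = c ^ j * elem_sym j n x"
  unfolding elem_sym_def sum_distrib_left
  by (intro sum.cong) (auto simp: prod.distrib)

lemma complete_sym_scale: "complete_sym j n (\<lambda>i. c * x i) = c ^ j * complete_sym j n x"
  unfolding complete_sym_def sum_distrib_left
  by (intro sum.cong) (auto simp: prod_mset.distrib prod_mset_constant multisets_of_size_def)

lemma complete_sym_0 [simp]: "complete_sym 0 n x = 1"
  by (simp add: complete_sym_def)

text \<open>Split by whether \<open>a\<close> occurs; if it does, one copy is removed. The set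
  difference keeps the two cases apart even when \<open>a\<close> already lies in
  \<open>A\<close>.\<close>

lemma multisets_of_size_insert_Suc:
  "multisets_of_size (insert a A) (Suc j) =
     (multisets_of_size A (Suc j) - {M. a \<in># M}) \<union> add_mset a ` multisets_of_size (insert a A) j"
proof (intro equalityI subsetI)
  fix M assume M: "M \<in> multisets_of_size (insert a A) (Suc j)"
  show "M \<in> (multisets_of_size A (Suc j) - {M. a \<in># M})
          \<union> add_mset a ` multisets_of_size (insert a A) j"
  proof (cases "a \<in># M")
    case True
    then obtain N where "M = add_mset a N" by (blast dest: multi_member_split)
    then show ?thesis using M by (auto simp: multisets_of_size_def)
  qed (use M in \<open>auto simp: multisets_of_size_def\<close>)
qed (auto simp: multisets_of_size_def)

lemma complete_sym_Suc_Suc: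
  "complete_sym (Suc j) (Suc n) x = complete_sym (Suc j) n x + x (Suc n) * complete_sym j (Suc n) x"
proof -
  let ?A = "multisets_of_size {1..n} (Suc j)" and ?B = "multisets_of_size {1..Suc n} j"
  have "Suc n \<notin># M" if "M \<in> ?A" for M
    using that by (auto simp: multisets_of_size_def)
  then have A: "?A - {M. Suc n \<in># M} = ?A" by blast
  have "{1..Suc n} = insert (Suc n) {1..n}" by auto
  then have "multisets_of_size {1..Suc n} (Suc j) = ?A \<union> add_mset (Suc n) ` ?B"
    by (metis A multisets_of_size_insert_Suc)
  moreover have "?A \<inter> add_mset (Suc n) ` ?B = {}"
    by (auto simp: multisets_of_size_def)
  ultimately show ?thesis
    unfolding complete_sym_def
    by (simp add: sum.union_disjoint finite_multisets_of_size sum.reindex inj_on_def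
        sum_distrib_left
        del: atLeastAtMostSuc_conv)
qed

lemma prod_fps_monom:
  "(\<Prod>i\<in>S. fps_const (a i) * fps_X ^ s) =
     fps_const (\<Prod>i\<in>S. a i) * (fps_X ^ (s * card S) :: 'b::comm_ring_1 fps)"
  by (induction S rule: infinite_finite_induct)
     (auto simp: algebra_simps power_add simp flip: fps_const_mult)

text \<open>Expanding the product, a subset \<open>S\<close> of the factors contributes a monomial
  of degree \<open>s * card S\<close>.\<close>

lemma elem_sym_generating:
  assumes "s \<ge> 1"
  shows "(\<Prod>i=1..n. 1 + fps_const (a i) * fps_X ^ s) = fps_spread s (\<lambda>j. elem_sym j n a)"
proof (rule fps_ext)
  fix m
  have "(\<Prod>i=1..n. 1 + fps_const (a i) * fps_X ^ s) =
          (\<Sum>S\<in>Pow {1..n}. \<Prod>i\<in>S. fps_const (a i) * fps_X ^ s)"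
    by (subst add.commute) (simp add: prod_add)
  then have "fps_nth (\<Prod>i=1..n. 1 + fps_const (a i) * fps_X ^ s) m =
          (\<Sum>S\<in>Pow {1..n}. if m = s * card S then \<Prod>i\<in>S. a i else 0)"
    by (simp add: prod_fps_monom fps_sum_nth if_distrib cong: if_cong)
  also have "\<dots> = (\<Sum>S | S \<subseteq> {1..n} \<and> m = s * card S. \<Prod>i\<in>S. a i)"
    by (intro sum.mono_neutral_cong_right) auto
  also have "\<dots> = fps_nth (fps_spread s (\<lambda>j. elem_sym j n a)) m"
  proof (cases "s dvd m")
    case True
    then have "m = s * card S \<longleftrightarrow> card S = m div s" for S :: "nat set"
      using assms by auto
    then show ?thesis using True by (simp add: fps_spread_nth elem_sym_def)
  next
    case False
    then have "{S. S \<subseteq> {1..n} \<and> m = s * card S} = {}" by auto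
    then show ?thesis using False by (simp only: fps_spread_nth sum.empty if_False)
  qed
  finally show "fps_nth (\<Prod>i=1..n. 1 + fps_const (a i) * fps_X ^ s) m =
                fps_nth (fps_spread s (\<lambda>j. elem_sym j n a)) m" .
qed

text \<open>Induction on \<open>n\<close>: the factor of the new variable reduces the series for
  \<open>Suc n\<close> variables to that for \<open>n\<close>, which is the recurrence
  \<open>complete_sym_Suc_Suc\<close> read coefficientwise.\<close>

lemma complete_sym_generating:
  assumes "s \<ge> 1"
  shows "fps_spread s (\<lambda>j. complete_sym j n a) * (\<Prod>i=1..n. 1 - fps_const (a i) * fps_X ^ s) = 1"
proof (induction n)
  case 0
  have "complete_sym j 0 a = (if j = 0 then 1 else 0)" for j
    by (simp add: complete_sym_def)
  then show ?case
    using assms by (auto simp: fps_eq_iff fps_spread_nth dvd_div_eq_0_iff)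
next
  case (Suc n)
  let ?C = "\<lambda>n. fps_spread s (\<lambda>j. complete_sym j n a)"
  have "fps_nth (?C (Suc n) * (1 - fps_const (a (Suc n)) * fps_X ^ s)) m = fps_nth (?C n) m" for m
  proof -
    have "fps_nth (?C (Suc n) * (1 - fps_const (a (Suc n)) * fps_X ^ s)) m =
        fps_nth (?C (Suc n) - fps_const (a (Suc n)) * (?C (Suc n) * fps_X ^ s)) m"
      by (simp add: algebra_simps)
    also have "\<dots> = fps_nth (?C (Suc n)) m
        - a (Suc n) * (if m < s then 0 else fps_nth (?C (Suc n)) (m - s))"
      by (simp add: fps_X_power_mult_right_nth)
    also have "\<dots> = fps_nth (?C n) m"
    proof (cases "s dvd m")
      case True
      then obtain j where j: "m = s * j" by blast
      show ?thesis
      proof (cases j)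
        case (Suc i)
        then have "m - s = s * i" "\<not> m < s" using j by auto
        then show ?thesis
          using assms j Suc by (simp add: fps_spread_nth complete_sym_Suc_Suc del: mult_Suc_right)
      \<comment> \<open>Here \<open>m = 0 < s\<close>, so the shifted term vanishes and both
        constant coefficients are 1.\<close>
      qed (use assms j in \<open>simp add: fps_spread_nth\<close>)
    next
      case False
      then have "\<not> s dvd m - s" if "\<not> m < s"
        using that by (simp add: dvd_minus_self)
      then show ?thesis using False by (simp add: fps_spread_nth)
    qed
    finally show ?thesis .
  qed
  then have "?C (Suc n) * (1 - fps_const (a (Suc n)) * fps_X ^ s) = ?C n"
    by (rule fps_ext)
  then show ?case
    using Suc by (simp add: mult.assoc[symmetric] mult.commute mult.left_commute)
qed

lemma trunc_geom_mult:
  assumes "s \<ge> 1"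
  shows "trunc_geom (s - 1) a * (1 - fps_const a * fps_X) = 1 - fps_const (a ^ s) * fps_X ^ s"
proof -
  have "{0..s - 1} = {..<s}" using assms by auto
  moreover have "1 - fps_const (a ^ s) * fps_X ^ s = 1 - (fps_const a * fps_X) ^ s"
    by (simp add: power_mult_distrib)
  ultimately show ?thesis
    by (simp only: trunc_geom_def one_diff_power_eq mult.commute)
qed

lemma prod_trunc_geom_mult:
  assumes "s \<ge> 1"
  shows "(\<Prod>i=1..n. trunc_geom (s - 1) (a i)) * (\<Prod>i=1..n. 1 - fps_const (a i) * fps_X) =
         (\<Prod>i=1..n. 1 - fps_const (a i ^ s) * fps_X ^ s)"
  by (simp only: trunc_geom_mult[OF assms] flip: prod.distrib)

lemma E_trunc_eq:
  assumes "s \<ge> 1"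
  shows "E_trunc (s - 1) k n x =
    (\<Sum>j=0..k div s. (-1) ^ j * elem_sym j n (\<lambda>i. x i ^ s) * complete_sym (k - s * j) n x)"
proof -
  let ?T = "\<Prod>i=1..n. trunc_geom (s - 1) (x i)"
  let ?C = "fps_spread 1 (\<lambda>j. complete_sym j n x)"
  \<comment> \<open>The explicit factor \<open>- 1\<close> lets \<open>elem_sym_scale\<close>
    produce \<open>(-1) ^ j\<close>.\<close>
  let ?E = "fps_spread s (\<lambda>j. elem_sym j n (\<lambda>i. - 1 * x i ^ s))"
  have E: "(\<Prod>i=1..n. 1 - fps_const (x i ^ s) * fps_X ^ s) = ?E"
    using elem_sym_generating[OF assms, of "\<lambda>i. - 1 * x i ^ s" n]
    by (simp flip: fps_const_neg)
  have "?T = ?T * (?C * (\<Prod>i=1..n. 1 - fps_const (x i) * fps_X))"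
    using complete_sym_generating[of 1 n x] by simp
  also have "\<dots> = (?T * (\<Prod>i=1..n. 1 - fps_const (x i) * fps_X)) * ?C"
    by (simp only: mult_ac)
  also have "\<dots> = ?E * ?C"
    by (simp only: prod_trunc_geom_mult[OF assms] E)
  finally have "?T = ?E * ?C" .
  then show ?thesis
    unfolding E_trunc_def elem_sym_scale
    by (simp add: fps_spread_mult_nth[OF assms])
qed

lemma H_trunc_eq:
  assumes "s \<ge> 1"
  shows "H_trunc (s - 1) k n x =
    (\<Sum>j=0..k div s. (-1) ^ (s * j) * complete_sym j n (\<lambda>i. x i ^ s) * elem_sym (k - s * j) n x)"
proof -
  let ?T = "\<Prod>i=1..n. trunc_geom (s - 1) (- x i)"
  let ?I = "\<Prod>i=1..n. fps_right_inverse (trunc_geom (s - 1) (- x i)) 1"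
  let ?E = "fps_spread 1 (\<lambda>j. elem_sym j n x)"
  \<comment> \<open>This is \<open>(- x i) ^ s\<close> with its sign split off, so that scaling
    gives \<open>((-1) ^ s) ^ j\<close>.\<close>
  let ?C = "fps_spread s (\<lambda>j. complete_sym j n (\<lambda>i. (- 1) ^ s * x i ^ s))"
  let ?P = "\<Prod>i=1..n. 1 - fps_const ((- x i) ^ s) * fps_X ^ s"
  have CP: "?C * ?P = 1"
    using complete_sym_generating[OF assms, of n "\<lambda>i. (- x i) ^ s"]
    by (simp only: power_minus[of "x _"])
  have TI: "?T * ?I = 1"
    by (simp add: trunc_geom_inverse flip: prod.distrib)
  have E: "(\<Prod>i=1..n. 1 - fps_const (- x i) * fps_X) = ?E"
    using elem_sym_generating[of 1 x n] by (simp flip: fps_const_neg)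
  have TE: "?T * ?E = ?P"
    using prod_trunc_geom_mult[OF assms, of "\<lambda>i. - x i" n] by (simp only: E)
  \<comment> \<open>Since \<open>?T * ?E = ?P\<close> and \<open>?C\<close> inverts
    \<open>?P\<close>, the product \<open>?C * ?E\<close> is also an inverse of \<open>?T\<close>;
    uniqueness of inverses identifies it with \<open>?I\<close>.\<close>
  have "?I = (?C * (?T * ?E)) * ?I"
    by (simp only: TE CP mult_1_left)
  also have "\<dots> = (?T * ?I) * (?C * ?E)"
    by (simp only: mult_ac)
  finally have "?I = ?C * ?E"
    by (simp only: TI mult_1_left)
  then show ?thesis
    unfolding H_trunc_def complete_sym_scale
    by (simp add: fps_spread_mult_nth[OF assms] power_mult)
qed

theorem theorem3p3:
  fixes k n s :: nat and x :: "nat \<Rightarrow> 'a::comm_ring_1 mpoly"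
  assumes "k \<ge> 1" and "n \<ge> 1" and "s \<ge> 1"
    and "x = indet"
  shows "H_trunc (s - 1) k n x =
           (\<Sum>j=0..k div s. (-1) ^ (s * j) * complete_sym j n (\<lambda>i. x i ^ s) * elem_sym (k - s * j) n x)
       \<and> E_trunc (s - 1) k n x =
           (\<Sum>j=0..k div s. (-1) ^ j * elem_sym j n (\<lambda>i. x i ^ s) * complete_sym (k - s * j) n x)"
  using H_trunc_eq[OF assms(3)] E_trunc_eq[OF assms(3)] by blast

end
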